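(* There is a deterministic finite automaton with $17$ states, reading triples over the alphabet $\{-1,0,1\}\times\{0,1\}\times\{0,1\}$, such that for every finite sequence $\mathbf f\in\{-1,1\}^*$ with $|\mathbf f|\ge1$ and all integers $n,x\ge 0$, it accepts the parallel input consisting of $\mathbf f$ (padded with trailing $0$'s), $n$ and $x$ (written in base $2$, least-significant digit first, padded with trailing $0$'s; all three of a common length) if and only if $0\le n\le 2^{|\mathbf f|-1}$ and $x=S_{\mathbf f}[n]$. Likewise there is a deterministic finite automaton with $13$ states with the same property for $E_{\mathbf f}[n]$ in place of $S_{\mathbf f}[n]$. That is, a single synchronized automaton computes $S_{\mathbf f}$ (resp. $E_{\mathbf f}$) for all paperfolding sequences simultaneously.
   Context: For a finite sequence $\mathbf f$ over $\{-1,1\}$ define $P_\epsilon=\epsilon$ (empty) and $P_{\mathbf f a}=P_{\mathbf f}\ a\ (-P_{\mathbf f}^R)$ for $a\in\{-1,1\}$, where $-x$ negates every entry and $x^R$ is reversal; $|P_{\mathbf f}|=2^{|\mathbf f|}-1$. Index $P_{\mathbf f}=p_1p_2\cdots$ from $1$. A run is a maximal block of consecutive identical entries; runs are numbered left to right from $1$, and $S_{\mathbf f}[n]$, $E_{\mathbf f}[n]$ denote the starting and ending positions of the $n$-th run ($P_{\mathbf f}$ has $2^{|\mathbf f|-1}$ runs). By convention $S_{\mathbf f}[0]=E_{\mathbf f}[0]=0$. The unfolding instructions are fed to the automaton as a word over $\{-1,0,1\}$ consisting of $\mathbf f$ followed by $0$'s; $0$'s are allowed only at the end and are ignored. *)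

theory Defs
  imports Main "HOL-Library.Product_Lexorder"
begin

section \<open>Paperfolding sequences and their runs\<close>

definition paperfold :: "int list \<Rightarrow> int list" where
  "paperfold f = foldl (\<lambda>p a. p @ [a] @ map uminus (rev p)) [] f"

lemma paperfold_Nil: "paperfold [] = []"
  by (simp add: paperfold_def)

lemma paperfold_snoc:
  "paperfold (f @ [a]) = paperfold f @ [a] @ map uminus (rev (paperfold f))"
  by (simp add: paperfold_def)

text \<open>Positions are counted from 1, so the entry at position \<open>i\<close> is \<open>xs ! (i - 1)\<close>.\<close>

definition is_run :: "'a list \<Rightarrow> nat \<Rightarrow> nat \<Rightarrow> bool" where
  "is_run xs s e \<longleftrightarrow>
     1 \<le> s \<and> s \<le> e \<and> e \<le> length xs \<and>
     (\<forall>i\<in>{s..e}. xs ! (i - 1) = xs ! (s - 1)) \<and>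
     (s = 1 \<or> xs ! (s - 2) \<noteq> xs ! (s - 1)) \<and>
     (e = length xs \<or> xs ! e \<noteq> xs ! (e - 1))"

text \<open>The pairs are ordered lexicographically. Distinct runs have distinct starting
  positions, so this lists the runs from left to right.\<close>

definition runs :: "'a list \<Rightarrow> (nat \<times> nat) list" where
  "runs xs = sorted_list_of_set {(s, e). is_run xs s e}"

text \<open>The values for \<open>n > 2 ^ (length f - 1)\<close>, where there is no \<open>n\<close>-th run, carry no meaning.\<close>

definition run_start :: "int list \<Rightarrow> nat \<Rightarrow> nat" where
  "run_start f n = (if n = 0 then 0 else fst (runs (paperfold f) ! (n - 1)))"

definition run_end :: "int list \<Rightarrow> nat \<Rightarrow> nat" where
  "run_end f n = (if n = 0 then 0 else snd (runs (paperfold f) ! (n - 1)))"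


section \<open>Deterministic finite automata\<close>

record ('q, 'a) dfa =
  states :: "'q set"
  init :: 'q
  step :: "'q \<Rightarrow> 'a \<Rightarrow> 'q"
  final :: "'q set"

text \<open>Transition functions are total on the alphabet, so a dead state counts as a state.\<close>

definition is_dfa :: "'a set \<Rightarrow> ('q, 'a) dfa \<Rightarrow> bool" where
  "is_dfa \<Sigma> M \<longleftrightarrow>
     finite (states M) \<and> init M \<in> states M \<and> final M \<subseteq> states M \<and>
     (\<forall>q\<in>states M. \<forall>a\<in>\<Sigma>. step M q a \<in> states M)"

definition accepts :: "('q, 'a) dfa \<Rightarrow> 'a list \<Rightarrow> bool" where
  "accepts M w \<longleftrightarrow> foldl (step M) (init M) w \<in> final M"


section \<open>Parallel input\<close>

definition input_alphabet :: "(int \<times> nat \<times> nat) set" where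
  "input_alphabet = {-1, 0, 1} \<times> {0, 1} \<times> {0, 1}"

definition pad :: "nat \<Rightarrow> int list \<Rightarrow> int list" where
  "pad L f = f @ replicate (L - length f) 0"

text \<open>The \<open>L\<close> least significant binary digits, least significant first; for \<open>n < 2 ^ L\<close>
  this is the binary representation of \<open>n\<close> padded with zeros to length \<open>L\<close>.\<close>

definition lsd_digits :: "nat \<Rightarrow> nat \<Rightarrow> nat list" where
  "lsd_digits L n = map (\<lambda>i. n div 2 ^ i mod 2) [0..<L]"

definition parallel_input :: "nat \<Rightarrow> int list \<Rightarrow> nat \<Rightarrow> nat \<Rightarrow> (int \<times> nat \<times> nat) list" where
  "parallel_input L f n x = zip (pad L f) (zip (lsd_digits L n) (lsd_digits L x))"

text \<open>\<open>L\<close> is the common length: it ranges over all lengths at which \<open>f\<close>, \<open>n\<close> and \<open>x\<close> fit.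
  Words whose first component is not \<open>f\<close> followed by zeros are unconstrained.\<close>

definition synchronized_for ::
    "('q, int \<times> nat \<times> nat) dfa \<Rightarrow> (int list \<Rightarrow> nat \<Rightarrow> nat) \<Rightarrow> bool" where
  "synchronized_for M F \<longleftrightarrow>
     (\<forall>f n x L. set f \<subseteq> {-1, 1} \<longrightarrow> length f \<ge> 1 \<longrightarrow>
        length f \<le> L \<longrightarrow> n < 2 ^ L \<longrightarrow> x < 2 ^ L \<longrightarrow>
        (accepts M (parallel_input L f n x) \<longleftrightarrow> n \<le> 2 ^ (length f - 1) \<and> x = F f n))"

end

theory Submission
  imports Defs
begin

text \<open>In \<open>P\<^bsub>a g\<^esub>\<close> the entry at position \<open>2 j + 1\<close> is \<open>a (-1)\<^sup>j\<close> and the entry at position \<open>2 j\<close>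
  is the \<open>j\<close>-th entry of \<open>P\<^bsub>g\<^esub>\<close>. As the entries at odd positions alternate, the \<open>n\<close>-th run starts at
  \<open>2 (n - 1)\<close> or \<open>2 (n - 1) + 1\<close>, and the choice is decided by a single entry of \<open>P\<^bsub>g\<^esub>\<close>. The entry at
  position \<open>2\<^sup>k m\<close>, \<open>m\<close> odd, depends only on the \<open>k\<close>-th instruction and on \<open>m mod 4\<close>, so an automaton
  reading least significant digits first evaluates it while comparing \<open>x\<close> with \<open>2 n\<close> or \<open>2 (n - 1)\<close>
  by means of a carry and a borrow. This takes 16 states for the starting and 12 for the ending
  positions; unreachable states make up the required numbers.\<close>

section \<open>Entries of paperfolding sequences\<close>

definition entry :: "int list \<Rightarrow> nat \<Rightarrow> int" where
  "entry f i = paperfold f ! (i - 1)"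

lemma length_paperfold: "length (paperfold f) = 2 ^ length f - 1"
proof (induction f rule: rev_induct)
  case Nil
  then show ?case by (simp add: paperfold_Nil)
next
  case (snoc a f)
  have "(1::nat) \<le> 2 ^ length f" by simp
  then show ?case by (simp add: paperfold_snoc snoc.IH)
qed

lemma entry_snoc:
  assumes "1 \<le> i" "i < 2 ^ Suc (length f)"
  shows "entry (f @ [a]) i =
    (if i < 2 ^ length f then entry f i
     else if i = 2 ^ length f then a else - entry f (2 ^ Suc (length f) - i))"
proof -
  consider "i < 2 ^ length f" | "i = 2 ^ length f" | "2 ^ length f < i" by linarith
  then show ?thesis
  proof cases
    case 1
    then show ?thesis using assms
      by (simp add: entry_def paperfold_snoc nth_append length_paperfold less_diff_conv)
  next
    case 2
    then show ?thesis
      by (simp add: entry_def paperfold_snoc nth_append length_paperfold)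
  next
    case 3
    have "2 ^ length f - 1 - Suc (i - 1 - 2 ^ length f) = 2 ^ Suc (length f) - i - 1"
      using 3 assms by simp
    moreover have "i - 1 - 2 ^ length f < 2 ^ length f - 1"
      using 3 assms by (simp add: less_diff_conv)
    moreover have "\<not> i - 1 < 2 ^ length f - 1" "i - 1 - (2 ^ length f - 1) = Suc (i - 1 - 2 ^ length f)"
      using 3 by (simp_all add: not_less)
    ultimately show ?thesis using 3
      by (simp add: entry_def paperfold_snoc nth_append length_paperfold rev_nth)
  qed
qed

text \<open>The definition adds instructions at the end, hence the induction from the right. The
  reflection of i to 4 N - i preserves the parity of i; for odd i it flips the parity of the half,
  and this absorbs the negation.\<close>

lemma entry_Cons:
  "1 \<le> i \<Longrightarrow> i < 2 ^ Suc (length f) \<Longrightarrow>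
    entry (a # f) i = (if even i then entry f (i div 2) else if even (i div 2) then a else - a)"
proof (induction f arbitrary: i rule: rev_induct)
  case Nil
  then have "i = 1" by simp
  then show ?case using entry_snoc[of 1 "[]" a] by simp
next
  case (snoc b f)
  define N :: nat where "N = 2 ^ length f"
  have N: "N > 0" by (simp add: N_def)
  have i: "1 \<le> i" "i < 4 * N" using snoc.prems by (simp_all add: N_def)
  have outer: "entry (a # f @ [b]) i =
      (if i < 2 * N then entry (a # f) i else if i = 2 * N then b else - entry (a # f) (4 * N - i))"
    using entry_snoc[of i "a # f" b] i by (simp add: N_def)
  consider "i < 2 * N" | "i = 2 * N" | "2 * N < i" by linarith
  then show ?case
  proof cases
    case 1
    then have "even i \<Longrightarrow> entry (f @ [b]) (i div 2) = entry f (i div 2)"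
      using i entry_snoc[of "i div 2" f b] by (auto simp: N_def elim!: evenE)
    then show ?thesis using 1 i outer snoc.IH[of i] by (simp add: N_def)
  next
    case 2
    then show ?thesis using outer N entry_snoc[of N f b] by (simp add: N_def)
  next
    case 3
    have IH: "entry (a # f) (4 * N - i) =
        (if even (4 * N - i) then entry f ((4 * N - i) div 2)
         else if even ((4 * N - i) div 2) then a else - a)"
      using snoc.IH[of "4 * N - i"] 3 i by (simp add: N_def)
    show ?thesis
    proof (cases "even i")
      case True
      then obtain j where j: "i = 2 * j" by (elim evenE)
      then have "(4 * N - i) div 2 = 2 * N - j" by simp
      moreover have "entry (f @ [b]) j = - entry f (2 * N - j)"
        using entry_snoc[of j f b] 3 i j by (simp add: N_def)
      ultimately show ?thesis using outer IH 3 j by simp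
    next
      case False
      then obtain j where j: "i = 2 * j + 1" by (elim oddE)
      then have "(4 * N - i) div 2 = 2 * N - 1 - j" "odd (4 * N - i)" using i by presburger+
      moreover have "even (2 * N - 1 - j) \<longleftrightarrow> odd j" using i j by presburger
      ultimately show ?thesis using outer IH 3 j by simp
    qed
  qed
qed

lemma entry_Cons_even: "1 \<le> i \<Longrightarrow> i < 2 ^ length f \<Longrightarrow> entry (a # f) (2 * i) = entry f i"
  using entry_Cons[of "2 * i" f a] by simp

lemma entry_Cons_odd: "i < 2 ^ length f \<Longrightarrow> entry (a # f) (2 * i + 1) = (if even i then a else - a)"
  using entry_Cons[of "2 * i + 1" f a] by simp

lemma entry_pm:
  "set f \<subseteq> {-1, 1} \<Longrightarrow> 1 \<le> i \<Longrightarrow> i < 2 ^ length f \<Longrightarrow> entry f i = -1 \<or> entry f i = 1"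
proof (induction f arbitrary: i)
  case (Cons a f)
  have "even i \<Longrightarrow> entry f (i div 2) = -1 \<or> entry f (i div 2) = 1"
    using Cons.prems by (intro Cons.IH) auto
  then show ?case using entry_Cons[of i f a] Cons.prems by auto
qed simp

section \<open>Runs\<close>

lemma is_run_nth:
  assumes "is_run xs s e" "s \<le> i" "i \<le> e"
  shows "xs ! (i - 1) = xs ! (s - 1)"
proof -
  have "\<forall>i\<in>{s..e}. xs ! (i - 1) = xs ! (s - 1)" using assms(1) unfolding is_run_def by blast
  then show ?thesis by (rule bspec) (use assms in simp)
qed

text \<open>A longer run from the same start would contain position \<open>Suc e\<close>, against
  the maximality of the shorter one.\<close>

lemma is_run_end_unique:
  assumes "is_run xs s e" "is_run xs s e'"
  shows "e = e'"
proof -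
  have "\<not> e < e'" if "is_run xs s e" "is_run xs s e'" for e e'
  proof
    assume "e < e'"
    have b: "s \<le> e" "e' \<le> length xs" "e = length xs \<or> xs ! e \<noteq> xs ! (e - 1)"
      using that unfolding is_run_def by blast+
    have "xs ! (Suc e - 1) = xs ! (e - 1)"
      using is_run_nth[OF that(1), of e] is_run_nth[OF that(2), of "Suc e"] b \<open>e < e'\<close> by simp
    then show False using b \<open>e < e'\<close> by simp
  qed
  from this[OF assms] this[OF assms(2,1)] show ?thesis by simp
qed

text \<open>\<open>S\<close> enumerates 1 and the positions where the entry changes; the sentinel
  \<open>S (Suc N)\<close> lets the last run end like all others.\<close>

lemma runs_eq_map:
  assumes mono: "strict_mono_on {1..Suc N} S" and first: "S 1 = 1" and last: "S (Suc N) = Suc (length xs)"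
    and change: "\<And>i. 1 \<le> i \<Longrightarrow> i < length xs \<Longrightarrow> xs ! (i - 1) \<noteq> xs ! i \<longleftrightarrow> Suc i \<in> S ` {1..N}"
  shows "runs xs = map (\<lambda>n. (S n, S (Suc n) - 1)) [1..<Suc N]"
proof -
  have less: "S m < S n \<longleftrightarrow> m < n" if "m \<in> {1..Suc N}" "n \<in> {1..Suc N}" for m n
    using strict_mono_on_less[OF mono that] .
  have le: "S m \<le> S n \<longleftrightarrow> m \<le> n" if "m \<in> {1..Suc N}" "n \<in> {1..Suc N}" for m n
    using strict_mono_on_less_eq[OF mono that] .
  have run: "is_run xs (S n) (S (Suc n) - 1)" if n: "n \<in> {1..N}" for n
  proof -
    have b: "1 \<le> S n" "S n < S (Suc n)" "S (Suc n) \<le> Suc (length xs)"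
      using n le[of 1 n] first less[of n "Suc n"] le[of "Suc n" "Suc N"] last by auto
    have const: "xs ! (i - 1) = xs ! (S n - 1)" if "S n \<le> i" "i < S (Suc n)" for i
      using that
    proof (induction i rule: dec_induct)
      case (step i)
      \<comment> \<open>A change here would be some \<open>S m\<close> strictly between
        \<open>S n\<close> and \<open>S (Suc n)\<close>, which leaves no room for
        \<open>m\<close>.\<close>
      have "Suc i \<notin> S ` {1..N}"
      proof
        assume "Suc i \<in> S ` {1..N}"
        then obtain m where m: "m \<in> {1..N}" "Suc i = S m" by auto
        then have "n < m" "m < Suc n"
          using step less[of n m] less[of m "Suc n"] n by auto
        then show False by simp
      qed
      then show ?case using change[of i] step b by auto
    qed simp
    have "S n = 1 \<or> xs ! (S n - 2) \<noteq> xs ! (S n - 1)"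
    proof (cases "S n = 1")
      case False
      then show ?thesis using change[of "S n - 1"] b n
        by (auto simp: numeral_2_eq_2)
    qed simp
    moreover have "S (Suc n) - 1 = length xs \<or> xs ! (S (Suc n) - 1) \<noteq> xs ! (S (Suc n) - 1 - 1)"
    proof (cases "n = N")
      case False
      then have "S (Suc n) < Suc (length xs)" "Suc n \<in> {1..N}"
        using n less[of "Suc n" "Suc N"] last by auto
      moreover from this have "1 \<le> S (Suc n) - 1" "S (Suc n) - 1 < length xs" using b by linarith+
      ultimately show ?thesis using change[of "S (Suc n) - 1"] b by fastforce
    qed (use last in simp)
    moreover have "\<forall>i\<in>{S n..S (Suc n) - 1}. xs ! (i - 1) = xs ! (S n - 1)"
      using b(2) by (intro ballI const) auto
    moreover have "S n \<le> S (Suc n) - 1" "S (Suc n) - 1 \<le> length xs" using b by linarith+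
    ultimately show ?thesis unfolding is_run_def using b(1) by blast
  qed
  have "is_run xs s e \<longleftrightarrow> (s, e) \<in> (\<lambda>n. (S n, S (Suc n) - 1)) ` {1..N}" for s e
  proof
    assume r: "is_run xs s e"
    have "s \<in> S ` {1..N}"
    proof (cases "s = 1")
      case True
      have "length xs \<noteq> 0" using r by (auto simp: is_run_def)
      then have "N \<noteq> 0" using first last by (cases N) simp_all
      then have "S 1 \<in> S ` {1..N}" by simp
      then show ?thesis using True first by simp
    next
      case False
      moreover have "1 \<le> s" "s \<le> e" "e \<le> length xs" "s = 1 \<or> xs ! (s - 2) \<noteq> xs ! (s - 1)"
        using r unfolding is_run_def by blast+
      moreover have "s - 1 - 1 = s - 2" by simp
      ultimately have "1 \<le> s - 1" "s - 1 < length xs" "Suc (s - 1) = s" "xs ! (s - 1 - 1) \<noteq> xs ! (s - 1)"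
        by auto
      then show ?thesis using change[of "s - 1"] by simp
    qed
    then obtain n where "n \<in> {1..N}" "s = S n" by auto
    then have "(s, e) = (S n, S (Suc n) - 1)" using is_run_end_unique[OF r] run by simp
    then show "(s, e) \<in> (\<lambda>n. (S n, S (Suc n) - 1)) ` {1..N}"
      using \<open>n \<in> {1..N}\<close> by blast
  next
    assume "(s, e) \<in> (\<lambda>n. (S n, S (Suc n) - 1)) ` {1..N}"
    then show "is_run xs s e" using run by blast
  qed
  then have set: "{(s, e). is_run xs s e} = set (map (\<lambda>n. (S n, S (Suc n) - 1)) [1..<Suc N])"
    by (auto simp: atLeastLessThanSuc_atLeastAtMost simp del: upt_Suc)
  \<comment> \<open>First components increase strictly, so the list is lexicographically sorted
    without repetition.\<close>
  have "sorted_wrt (<) (map (\<lambda>n. (S n, S (Suc n) - 1)) [1..<Suc N])"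
    unfolding sorted_wrt_map
    by (rule sorted_wrt_mono_rel[OF _ sorted_wrt_upt]) (use less in \<open>auto simp: less_prod_def'\<close>)
  then show ?thesis unfolding runs_def set
    by (intro sorted_list_of_set.idem_if_sorted_distinct) (simp_all only: strict_sorted_iff)
qed

text \<open>The value at \<open>n = 2 ^ length g + 1\<close>, one past the last run, is one past the last position.\<close>

definition fold_start :: "int \<Rightarrow> int list \<Rightarrow> nat \<Rightarrow> nat" where
  "fold_start a g n =
    (if n = 1 then 1
     else if n = Suc (2 ^ length g) then 2 ^ Suc (length g)
     else if entry g (n - 1) = (if even (n - 1) then a else - a) then 2 * (n - 1) else 2 * (n - 1) + 1)"

text \<open>The two odd neighbours of position 2 j have opposite signs, so the entry there differs
  from exactly one of them and exactly one run starts in {2 j, 2 j + 1}. It starts at 2 j iff that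
  entry agrees with its right neighbour a (-1)^j.\<close>

lemma runs_paperfold:
  assumes "set (a # g) \<subseteq> {-1, 1}"
  shows "runs (paperfold (a # g)) =
    map (\<lambda>n. (fold_start a g n, fold_start a g (Suc n) - 1)) [1..<Suc (2 ^ length g)]"
proof (rule runs_eq_map)
  let ?N = "2 ^ length g :: nat"
  let ?xs = "paperfold (a # g)"
  have a: "a = -1 \<or> a = 1" using assms by simp
  show "strict_mono_on {1..Suc ?N} (fold_start a g)"
  proof (rule strict_mono_onI)
    fix m n assume "m \<in> {1..Suc ?N}" "n \<in> {1..Suc ?N}" "m < n"
    then show "fold_start a g m < fold_start a g n" by (auto simp: fold_start_def)
  qed
  show "fold_start a g 1 = 1" by (simp add: fold_start_def)
  show "fold_start a g (Suc ?N) = Suc (length ?xs)"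
    by (simp add: fold_start_def length_paperfold)
  fix i assume i: "1 \<le> i" "i < length ?xs"
  then have i': "Suc i < 2 * ?N" by (simp add: length_paperfold)
  have xs: "?xs ! (i - 1) = entry (a # g) i" "?xs ! i = entry (a # g) (Suc i)"
    by (simp_all add: entry_def)
  \<comment> \<open>On \<open>{1..?N}\<close> the value at \<open>n\<close> is 2 (n - 1) or 2 (n -
    1) + 1, so halving it recovers n - 1 and only one candidate has to be tested.\<close>
  have start: "Suc i \<in> fold_start a g ` {1..?N} \<longleftrightarrow> fold_start a g (Suc (Suc i div 2)) = Suc i"
  proof
    assume "Suc i \<in> fold_start a g ` {1..?N}"
    then obtain n where n: "n \<in> {1..?N}" "fold_start a g n = Suc i" by auto
    then have "n = Suc (Suc i div 2)" using i by (auto simp: fold_start_def split: if_splits)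
    then show "fold_start a g (Suc (Suc i div 2)) = Suc i" using n by simp
  next
    assume "fold_start a g (Suc (Suc i div 2)) = Suc i"
    moreover have "Suc (Suc i div 2) \<in> {1..?N}" using i' by auto
    ultimately show "Suc i \<in> fold_start a g ` {1..?N}" by (metis imageI)
  qed
  show "?xs ! (i - 1) \<noteq> ?xs ! i \<longleftrightarrow> Suc i \<in> fold_start a g ` {1..?N}"
  proof (cases "even i")
    case True
    then obtain j where j: "i = 2 * j" by (elim evenE)
    then have "1 \<le> j" "j < ?N" using i i' by auto
    then show ?thesis using j entry_Cons_even[of j g a] entry_Cons_odd[of j g a]
        entry_pm[of g j] a assms
      unfolding start xs by (auto simp: fold_start_def)
  next
    case False
    then obtain j where j: "i = 2 * j + 1" by (elim oddE)
    then have "Suc j < ?N" using i' by auto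
    then show ?thesis using j entry_Cons_even[of "Suc j" g a] entry_Cons_odd[of j g a]
        entry_pm[of g "Suc j"] a assms
      unfolding start xs by (auto simp: fold_start_def)
  qed
qed

lemma run_start_Cons:
  assumes "set (a # g) \<subseteq> {-1, 1}" "1 \<le> n" "n \<le> 2 ^ length g"
  shows "run_start (a # g) n = fold_start a g n"
  using assms nth_upt[of 1 "n - 1" "Suc (2 ^ length g)"]
  by (simp add: run_start_def runs_paperfold del: upt_Suc)

lemma run_end_Cons:
  assumes "set (a # g) \<subseteq> {-1, 1}" "1 \<le> n" "n \<le> 2 ^ length g"
  shows "run_end (a # g) n = fold_start a g (Suc n) - 1"
  using assms nth_upt[of 1 "n - 1" "Suc (2 ^ length g)"]
  by (simp add: run_end_def runs_paperfold del: upt_Suc)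

section \<open>Automata\<close>

lemma lsd_digits_Suc: "lsd_digits (Suc L) n = n mod 2 # lsd_digits L (n div 2)"
  by (simp add: lsd_digits_def upt_conv_Cons map_Suc_upt[symmetric] div_mult2_eq del: upt_Suc)

lemma parallel_input_0: "parallel_input 0 f n x = []"
  by (simp add: parallel_input_def lsd_digits_def)

lemma parallel_input_Cons:
  "parallel_input (Suc L) (a # f) n x = (a, n mod 2, x mod 2) # parallel_input L f (n div 2) (x div 2)"
  by (simp add: parallel_input_def pad_def lsd_digits_Suc)

lemma parallel_input_Nil:
  "parallel_input (Suc L) [] n x = (0, n mod 2, x mod 2) # parallel_input L [] (n div 2) (x div 2)"
  by (simp add: parallel_input_def pad_def lsd_digits_Suc)

lemma parallel_input_alphabet:
  assumes "set f \<subseteq> {-1, 1}"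
  shows "set (parallel_input L f n x) \<subseteq> input_alphabet"
proof -
  have "set (pad L f) \<subseteq> {-1, 0, 1}" using assms by (auto simp: pad_def)
  moreover have "set (lsd_digits L m) \<subseteq> {0, 1}" for m by (auto simp: lsd_digits_def)
  ultimately have "set (pad L f) \<times> set (lsd_digits L n) \<times> set (lsd_digits L x) \<subseteq> input_alphabet"
    unfolding input_alphabet_def by (intro Sigma_mono)
  moreover have "set (parallel_input L f n x) \<subseteq>
      set (pad L f) \<times> set (lsd_digits L n) \<times> set (lsd_digits L x)"
    unfolding parallel_input_def by (auto dest: set_zip_leftD set_zip_rightD)
  ultimately show ?thesis by blast
qed

text \<open>Here \<open>sem q f n x\<close> describes the remaining inputs that are accepted from the state \<open>q\<close>.\<close>

lemma accepts_iff_sem: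
  assumes dfa: "is_dfa input_alphabet M"
    and base: "\<And>q. q \<in> states M \<Longrightarrow> q \<in> final M \<longleftrightarrow> sem q [] 0 0"
    and Nil: "\<And>q n x. q \<in> states M \<Longrightarrow>
      sem (step M q (0, n mod 2, x mod 2)) [] (n div 2) (x div 2) \<longleftrightarrow> sem q [] n x"
    and Cons: "\<And>q a f n x. set (a # f) \<subseteq> {-1, 1} \<Longrightarrow> q \<in> states M \<Longrightarrow>
      sem (step M q (a, n mod 2, x mod 2)) f (n div 2) (x div 2) \<longleftrightarrow> sem q (a # f) n x"
    and f: "set f \<subseteq> {-1, 1}" "length f \<le> L" and less: "n < 2 ^ L" "x < 2 ^ L"
  shows "accepts M (parallel_input L f n x) \<longleftrightarrow> sem (init M) f n x"
proof -
  have "foldl (step M) q (parallel_input L f n x) \<in> final M \<longleftrightarrow> sem q f n x"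
    if "q \<in> states M" for q
    using f less that
  proof (induction L arbitrary: q f n x)
    \<comment> \<open>With no letter left, \<open>f = []\<close> and n = x = 0.\<close>
    case 0
    then show ?case by (simp add: parallel_input_0 base)
  next
    case (Suc L)
    have less: "n div 2 < 2 ^ L" "x div 2 < 2 ^ L" using Suc.prems by auto
    have closed: "step M q (a, n mod 2, x mod 2) \<in> states M" if "a \<in> {-1, 0, 1}" for a
    proof -
      have "n mod 2 < 2" "x mod 2 < 2" by simp_all
      then have "(a, n mod 2, x mod 2) \<in> input_alphabet"
        using that unfolding input_alphabet_def less_2_cases_iff by (intro SigmaI) simp_all
      then show ?thesis using dfa Suc.prems(5) unfolding is_dfa_def by blast
    qed
    show ?case
    proof (cases f)
      case f: Nil
      then show ?thesis using Suc.IH[of "[]" "n div 2" "x div 2"] less closed Suc.prems(5) f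
        by (simp add: parallel_input_Nil Nil)
    next
      case f: (Cons a g)
      then have "a \<in> {-1, 0, 1}" using Suc.prems by auto
      then show ?thesis using f Suc.IH[of g "n div 2" "x div 2"] Suc.prems less closed Cons[of a g]
        by (simp add: parallel_input_Cons)
    qed
  qed
  then show ?thesis using dfa by (simp add: accepts_def is_dfa_def)
qed

section \<open>Renaming states and padding their number\<close>

lemma foldl_step_in_states:
  "is_dfa \<Sigma> M \<Longrightarrow> set w \<subseteq> \<Sigma> \<Longrightarrow> q \<in> states M \<Longrightarrow> foldl (step M) q w \<in> states M"
  by (induction w arbitrary: q) (auto simp: is_dfa_def)

text \<open>States are renamed to an initial segment of the naturals; the other numbers below
  \<open>k\<close> become unreachable states that loop on themselves.\<close>

lemma nat_dfa_card:
  fixes M :: "('q, 'a) dfa"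
  assumes dfa: "is_dfa \<Sigma> M" and k: "card (states M) \<le> k"
  obtains M' :: "(nat, 'a) dfa"
  where "is_dfa \<Sigma> M'" "card (states M') = k"
    "\<And>w. set w \<subseteq> \<Sigma> \<Longrightarrow> accepts M' w \<longleftrightarrow> accepts M w"
proof -
  have fin: "finite (states M)" using dfa by (simp add: is_dfa_def)
  then obtain h where h: "bij_betw h (states M) {0..<card (states M)}"
    using ex_bij_betw_finite_nat by blast
  have inj: "inj_on h (states M)" using h by (simp add: bij_betw_def)
  have ran: "h q < k" if "q \<in> states M" for q using bij_betwE[OF h] that k by fastforce
  define M' :: "(nat, 'a) dfa" where
    "M' = \<lparr>states = {..<k}, init = h (init M),
      step = (\<lambda>i a. if i \<in> h ` states M then h (step M (inv_into (states M) h i) a) else i),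
      final = h ` final M\<rparr>"
  have "is_dfa \<Sigma> M'"
    using dfa ran inj unfolding is_dfa_def M'_def by auto
  moreover have "card (states M') = k" by (simp add: M'_def)
  moreover have run: "foldl (step M') (h q) w = h (foldl (step M) q w)"
    if "set w \<subseteq> \<Sigma>" "q \<in> states M" for q w
    using that
  proof (induction w arbitrary: q)
    case (Cons a w)
    then have "step M q a \<in> states M" using dfa by (auto simp: is_dfa_def)
    then show ?case using Cons inj by (simp add: M'_def)
  qed simp
  have "accepts M' w \<longleftrightarrow> accepts M w" if "set w \<subseteq> \<Sigma>" for w
  proof -
    have i: "init M \<in> states M" and F: "final M \<subseteq> states M" using dfa by (auto simp: is_dfa_def)
    have "foldl (step M') (init M') w = h (foldl (step M) (init M) w)"
      using run[OF that i] by (simp add: M'_def)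
    then show ?thesis
      using inj_on_image_mem_iff[OF inj foldl_step_in_states[OF dfa that i] F]
      by (simp add: accepts_def M'_def)
  qed
  ultimately show thesis using that by blast
qed

lemma ex_nat_dfa_synchronized:
  fixes M :: "('q, int \<times> nat \<times> nat) dfa"
  assumes "is_dfa input_alphabet M" "card (states M) \<le> k" "synchronized_for M F"
  shows "\<exists>M' :: (nat, int \<times> nat \<times> nat) dfa.
    is_dfa input_alphabet M' \<and> card (states M') = k \<and> synchronized_for M' F"
proof -
  obtain M' :: "(nat, int \<times> nat \<times> nat) dfa" where M': "is_dfa input_alphabet M'" "card (states M') = k"
    "\<And>w. set w \<subseteq> input_alphabet \<Longrightarrow> accepts M' w \<longleftrightarrow> accepts M w"
    using nat_dfa_card[OF assms(1,2)] by blast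
  then have "synchronized_for M' F"
    using assms(3) parallel_input_alphabet unfolding synchronized_for_def by simp
  with M' show ?thesis by blast
qed

section \<open>Arithmetic of the last binary digit\<close>

lemma nat_bit_cases:
  obtains m where "n = 2 * m" | m where "n = Suc (2 * m)"
  by (metis evenE oddE Suc_eq_plus1)

lemma double_simps:
  "Suc (2 * m) < 2 * n \<longleftrightarrow> m < n" "Suc (2 * m) \<noteq> 2 * n" "2 * n \<noteq> Suc (2 * m)"
  "even m \<Longrightarrow> Suc m \<noteq> 2 * n" "even m \<Longrightarrow> 2 * n \<noteq> Suc m"
  "Suc (2 * m) \<noteq> 4 * n" "2 * m \<noteq> Suc (4 * n)"
  "Suc (Suc (2 * m)) = 2 * n \<longleftrightarrow> Suc m = n"
  "Suc (Suc (2 * m)) = 4 * n \<longleftrightarrow> Suc m = 2 * n" "2 * m = Suc (Suc (4 * n)) \<longleftrightarrow> m = Suc (2 * n)"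
  for m n :: nat
  by presburger+

text \<open>The \<open>Suc\<close> forms are those produced by splitting off a digit; the third
  equation serves \<open>entry f (x + 1)\<close> in \<open>end_sem\<close>.\<close>

lemma entry_Cons_double:
  "1 \<le> y \<Longrightarrow> y < 2 ^ length f \<Longrightarrow> entry (a # f) (2 * y) = entry f y"
  "y < 2 ^ length f \<Longrightarrow> entry (a # f) (Suc (2 * y)) = (if even y then a else - a)"
  "Suc y < 2 ^ length f \<Longrightarrow> entry (a # f) (Suc (Suc (2 * y))) = entry f (Suc y)"
  using entry_Cons_even[of y f a] entry_Cons_odd[of y f a] entry_Cons_even[of "Suc y" f a] by auto

lemmas entry_Cons_simps =
  entry_Cons_double entry_Cons_double[of "2 * m" for m, simplified]
  entry_Cons_double(2)[of "Suc (2 * m)" for m, simplified]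

subsection \<open>Starting positions\<close>

text \<open>Reading \<open>x = 2 (n - 1) + b\<close>, the position whose entry matters is \<open>t = n - 1\<close>, the integer half of
  \<open>x\<close>. The parameter \<open>s\<close> is the sign required of that entry; \<open>b\<close> is kept because \<open>t = 0\<close>
  (that is, \<open>n = 1\<close>) forces \<open>b = 1\<close>, and because \<open>n = x = 0\<close> is accepted.\<close>

datatype start_state =
  SInit | SDead | SZero | SBorrow | SCopy nat | SOdd int | SWait int nat | SPred int nat

text \<open>After the first letter, what remains of \<open>x\<close> is t. Odd \<open>n\<close>
  makes t even: \<open>SWait\<close> skips its zeros and \<open>SOdd\<close> reads its lowest 1.
  Even \<open>n\<close> makes t odd, and \<open>SPred\<close> decides at once. The digits of
  \<open>n\<close> run one place ahead of those of \<open>x\<close>, which reveals the residue mod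
  4. Asking for \<open>a \<noteq> 0\<close> where \<open>x\<close> has digit 1 keeps t in
  range.\<close>

fun start_step :: "start_state \<Rightarrow> int \<times> nat \<times> nat \<Rightarrow> start_state" where
  "start_step SInit (a, n, x) =
    (if a = 0 then SDead
     else if n = 1 then SWait (if x = 0 then a else - a) x
     else SPred (if x = 0 then - a else a) x)"
| "start_step (SWait s b) (a, n, x) =
    (if x = 0 then if n = 0 then SWait s b else SOdd s else SDead)"
| "start_step (SOdd s) (a, n, x) =
    (if x = 1 \<and> a \<noteq> 0 \<and> s = (if n = 0 then a else - a) then SCopy n else SDead)"
| "start_step (SPred s b) (a, n, x) =
    (if x = 1 \<and> a \<noteq> 0 \<and> s = (if n = 0 then - a else a) then if n = 0 then SBorrow else SCopy 0
     else if x = 0 \<and> n = 0 \<and> b = 0 then SZero else SDead)"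
| "start_step (SCopy c) (a, n, x) =
    (if x = c \<and> (x = 0 \<or> a \<noteq> 0) then SCopy n else SDead)"
| "start_step SBorrow (a, n, x) =
    (if x = 1 \<and> a \<noteq> 0 then if n = 0 then SBorrow else SCopy 0 else SDead)"
| "start_step SZero (a, n, x) = (if n = 0 \<and> x = 0 then SZero else SDead)"
| "start_step SDead _ = SDead"

text \<open>The bound on \<open>x\<close> replaces the one on \<open>n\<close>: with t = n - 1, n at
  most 2^k means t < 2^k. The second disjunct for \<open>SPred\<close> is the input n = x =
  0.\<close>

fun start_sem :: "start_state \<Rightarrow> int list \<Rightarrow> nat \<Rightarrow> nat \<Rightarrow> bool" where
  "start_sem SInit f n x \<longleftrightarrow> f \<noteq> [] \<and> n \<le> 2 ^ (length f - 1) \<and> x = run_start f n"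
| "start_sem (SWait s b) f n x \<longleftrightarrow>
    x = 2 * n \<and> x < 2 ^ length f \<and> (if x = 0 then b = 1 else entry f x = s)"
| "start_sem (SOdd s) f n x \<longleftrightarrow> x = 2 * n + 1 \<and> x < 2 ^ length f \<and> entry f x = s"
| "start_sem (SPred s b) f n x \<longleftrightarrow>
    x + 1 = 2 * n \<and> x < 2 ^ length f \<and> entry f x = s \<or> n = 0 \<and> x = 0 \<and> b = 0"
| "start_sem (SCopy c) f n x \<longleftrightarrow> x = 2 * n + c \<and> x < 2 ^ length f"
| "start_sem SBorrow f n x \<longleftrightarrow> x + 1 = 2 * n \<and> x < 2 ^ length f"
| "start_sem SZero f n x \<longleftrightarrow> n = 0 \<and> x = 0"
| "start_sem SDead f n x \<longleftrightarrow> False"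

definition start_dfa :: "(start_state, int \<times> nat \<times> nat) dfa" where
  "start_dfa = \<lparr>states = {SInit, SDead, SZero, SBorrow, SCopy 0, SCopy 1, SOdd (-1), SOdd 1,
      SWait (-1) 0, SWait (-1) 1, SWait 1 0, SWait 1 1,
      SPred (-1) 0, SPred (-1) 1, SPred 1 0, SPred 1 1},
    init = SInit, step = start_step,
    final = {SZero, SCopy 0, SWait (-1) 1, SWait 1 1, SPred (-1) 0, SPred 1 0}\<rparr>"

lemma is_dfa_start: "is_dfa input_alphabet start_dfa"
  by (auto simp: is_dfa_def start_dfa_def input_alphabet_def)

lemma card_start: "card (states start_dfa) = 16"
  by (simp add: start_dfa_def)

text \<open>This is solved for t = \<open>x div 2\<close>, the form that the automaton sees. Both
  candidates 2 t and 2 t + 1 halve to t = n - 1, and as the entry is a or -a, the parity of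
  \<open>x\<close> selects which sign is required.\<close>

lemma run_start_Cons_iff:
  assumes "set (a # f) \<subseteq> {-1, 1}"
  shows "n \<le> 2 ^ length f \<and> x = run_start (a # f) n \<longleftrightarrow>
    n = 0 \<and> x = 0 \<or>
    n = Suc (x div 2) \<and> x div 2 < 2 ^ length f \<and>
      (if x div 2 = 0 then x = 1
       else entry f (x div 2) = (if even (x div 2) = even x then a else - a))"
proof (cases "n = 0 \<or> n > 2 ^ length f")
  case True
  then show ?thesis by (auto simp: run_start_def)
next
  case False
  then obtain t where t: "n = Suc t" "t < 2 ^ length f" by (cases n) auto
  define y where "y = x div 2"
  have y: "x = 2 * y \<or> x = Suc (2 * y)" unfolding y_def by presburger
  have pm: "t \<noteq> 0 \<Longrightarrow> entry f t = a \<or> entry f t = - a"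
    using assms t entry_pm[of f t] by auto
  have "a \<noteq> - a" using assms by auto
  have start: "run_start (a # f) n =
      (if t = 0 then 1 else if entry f t = (if even t then a else - a) then 2 * t else 2 * t + 1)"
    using assms t by (simp add: run_start_Cons fold_start_def)
  show ?thesis
  proof (cases "y = t")
    case True
    then show ?thesis unfolding start y_def[symmetric] using y t pm \<open>a \<noteq> - a\<close>
      by (elim disjE) auto
  next
    case False
    then have "x \<noteq> run_start (a # f) n" unfolding start using y by auto
    then show ?thesis using t False unfolding y_def[symmetric] by simp
  qed
qed

lemma start_sem_Nil:
  assumes "q \<in> states start_dfa"
  shows "start_sem (start_step q (0, n mod 2, x mod 2)) [] (n div 2) (x div 2) \<longleftrightarrow> start_sem q [] n x"
  using assms
  by (cases n rule: nat_bit_cases; cases x rule: nat_bit_cases; cases q)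
    (auto simp: start_dfa_def double_simps)

text \<open>Only the meaning of \<open>SInit\<close> mentions runs. In the other states an even
  position is halved and \<open>a\<close> dropped, while an odd position is settled by
  \<open>a\<close> and the parity of its half.\<close>

lemma start_sem_Cons:
  assumes "set (a # f) \<subseteq> {-1, 1}" "q \<in> states start_dfa"
  shows "start_sem (start_step q (a, n mod 2, x mod 2)) f (n div 2) (x div 2) \<longleftrightarrow>
    start_sem q (a # f) n x"
proof (cases "q = SInit")
  case True
  have "a \<noteq> 0" using assms by auto
  have "start_sem q (a # f) n x \<longleftrightarrow> n \<le> 2 ^ length f \<and> x = run_start (a # f) n"
    by (simp add: True)
  then show ?thesis unfolding run_start_Cons_iff[OF assms(1)] unfolding True using \<open>a \<noteq> 0\<close>
    by (cases n rule: nat_bit_cases; cases x rule: nat_bit_cases; simp add: double_simps)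
      (auto simp: double_simps)
next
  case False
  have "a = -1 \<or> a = 1" using assms(1) by simp
  then show ?thesis using assms(2) False
    by (cases q; cases n rule: nat_bit_cases; cases x rule: nat_bit_cases)
      (auto simp: start_dfa_def double_simps entry_Cons_simps)
qed

lemma synchronized_start: "synchronized_for start_dfa run_start"
proof -
  have "accepts start_dfa (parallel_input L f n x) \<longleftrightarrow> start_sem SInit f n x"
    if "set f \<subseteq> {-1, 1}" "length f \<le> L" "n < 2 ^ L" "x < 2 ^ L" for f n x L
  proof -
    have "q \<in> final start_dfa \<longleftrightarrow> start_sem q [] 0 0" if "q \<in> states start_dfa" for q
      using that by (auto simp: start_dfa_def)
    moreover have "step start_dfa = start_step" "init start_dfa = SInit" by (simp_all add: start_dfa_def)
    ultimately show ?thesis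
      using accepts_iff_sem[OF is_dfa_start, where sem = start_sem] start_sem_Nil start_sem_Cons that by simp
  qed
  then show ?thesis by (auto simp: synchronized_for_def)
qed

subsection \<open>Ending positions\<close>

text \<open>Reading \<open>x = 2 n - d\<close>, the entry at position \<open>n\<close> is required to be \<open>s\<close>, except that \<open>d = 1\<close> is
  right for the last run, whatever \<open>s\<close> is.\<close>

datatype end_state = EInit | EDead | ECopy nat | EOdd int nat | EWait int nat

text \<open>After the first letter, what remains of \<open>x\<close> is n - d. For d = 1 it has ones
  below the lowest 1 of n, a zero there, and the digits of n above; hence \<open>x = d\<close> while
  waiting and \<open>x \<noteq> d\<close> at the turn. Padding at the turn is allowed only when n =
  2^k for k remaining instructions, the last run.\<close>

fun end_step :: "end_state \<Rightarrow> int \<times> nat \<times> nat \<Rightarrow> end_state" where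
  "end_step EInit (a, n, x) =
    (if a = 0 then EDead
     else if n = 1 then EOdd (if x = 0 then a else - a) x
     else EWait (if x = 0 then - a else a) x)"
| "end_step (EWait s d) (a, n, x) =
    (if x = d \<and> (x = 0 \<or> a \<noteq> 0) then if n = 0 then EWait s d else EOdd s d else EDead)"
| "end_step (EOdd s d) (a, n, x) =
    (if x = d then EDead
     else if a = 0 then if x = 0 \<and> n = 0 then ECopy 0 else EDead
     else if s = (if n = 0 then a else - a) then ECopy n else EDead)"
| "end_step (ECopy c) (a, n, x) =
    (if x = c \<and> (x = 0 \<or> a \<noteq> 0) then ECopy n else EDead)"
| "end_step EDead _ = EDead"

text \<open>Two positions escape the sign requirement: 0 when d = 0, which is the input n = x = 0,
  and \<open>2 ^ length f\<close> when d = 1, which is the last run.\<close>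

fun end_sem :: "end_state \<Rightarrow> int list \<Rightarrow> nat \<Rightarrow> nat \<Rightarrow> bool" where
  "end_sem EInit f n x \<longleftrightarrow> f \<noteq> [] \<and> n \<le> 2 ^ (length f - 1) \<and> x = run_end f n"
| "end_sem (EWait s d) f n x \<longleftrightarrow> x < 2 ^ length f \<and> x + d = 2 * n \<and>
    (if d = 0 then x \<noteq> 0 \<longrightarrow> entry f x = s
     else x + 1 \<noteq> 2 ^ length f \<longrightarrow> entry f (x + 1) = s)"
| "end_sem (EOdd s d) f n x \<longleftrightarrow> x < 2 ^ length f \<and> x + d = 2 * n + 1 \<and>
    (if d = 0 then entry f x = s
     else x + 1 \<noteq> 2 ^ length f \<longrightarrow> entry f (x + 1) = s)"
| "end_sem (ECopy c) f n x \<longleftrightarrow> x = 2 * n + c \<and> x < 2 ^ length f"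
| "end_sem EDead f n x \<longleftrightarrow> False"

definition end_dfa :: "(end_state, int \<times> nat \<times> nat) dfa" where
  "end_dfa = \<lparr>states = {EInit, EDead, ECopy 0, ECopy 1,
      EOdd (-1) 0, EOdd (-1) 1, EOdd 1 0, EOdd 1 1, EWait (-1) 0, EWait (-1) 1, EWait 1 0, EWait 1 1},
    init = EInit, step = end_step,
    final = {ECopy 0, EOdd (-1) 1, EOdd 1 1, EWait (-1) 0, EWait 1 0}\<rparr>"

lemma is_dfa_end: "is_dfa input_alphabet end_dfa"
  by (auto simp: is_dfa_def end_dfa_def input_alphabet_def)

lemma card_end: "card (states end_dfa) = 12"
  by (simp add: end_dfa_def)

text \<open>The parity of \<open>x\<close> is d, hence the two branches; n = 0 belongs to the even
  one and the last run to the odd one.\<close>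

lemma run_end_Cons_iff:
  assumes "set (a # f) \<subseteq> {-1, 1}"
  shows "n \<le> 2 ^ length f \<and> x = run_end (a # f) n \<longleftrightarrow>
    (if even x
     then x = 2 * n \<and> (n = 0 \<or> n < 2 ^ length f \<and> entry f n = (if even n then - a else a))
     else x + 1 = 2 * n \<and> (n = 2 ^ length f \<or> n < 2 ^ length f \<and> entry f n = (if even n then a else - a)))"
proof (cases "n = 0 \<or> n > 2 ^ length f")
  case True
  then show ?thesis by (cases "x = 0") (auto simp: run_end_def)
next
  case False
  then have n: "1 \<le> n" "n \<le> 2 ^ length f" by auto
  then have pm: "n < 2 ^ length f \<Longrightarrow> entry f n = a \<or> entry f n = - a"
    using assms entry_pm[of f n] by auto
  have "a \<noteq> - a" using assms by auto
  \<comment> \<open>\<open>C\<close> says that the next run begins at 2 n, so that this one ends at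
    2 n - 1; for the last run, 2 n is the sentinel value of \<open>fold_start\<close>.\<close>
  define C where "C \<longleftrightarrow> n = 2 ^ length f \<or> entry f n = (if even n then a else - a)"
  have C: "C \<longleftrightarrow> n = 2 ^ length f \<or> n < 2 ^ length f \<and> entry f n = (if even n then a else - a)"
    "\<not> C \<longleftrightarrow> n = 0 \<or> n < 2 ^ length f \<and> entry f n = (if even n then - a else a)"
    using n pm \<open>a \<noteq> - a\<close> unfolding C_def by auto
  have "run_end (a # f) n = (if C then 2 * n - 1 else 2 * n)"
    using assms n by (simp add: run_end_Cons fold_start_def C_def)
  then have "x = run_end (a # f) n \<longleftrightarrow> (if C then x + 1 = 2 * n else x = 2 * n)"
    using n by auto
  moreover have "even x \<Longrightarrow> x + 1 \<noteq> 2 * n" "odd x \<Longrightarrow> x \<noteq> 2 * n" by presburger+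
  ultimately show ?thesis unfolding C[symmetric] using n by (cases C; cases "even x") simp_all
qed

lemma end_sem_Nil:
  assumes "q \<in> states end_dfa"
  shows "end_sem (end_step q (0, n mod 2, x mod 2)) [] (n div 2) (x div 2) \<longleftrightarrow> end_sem q [] n x"
  using assms
  by (cases n rule: nat_bit_cases; cases x rule: nat_bit_cases; cases q)
    (auto simp: end_dfa_def double_simps)

lemma end_sem_Cons:
  assumes "set (a # f) \<subseteq> {-1, 1}" "q \<in> states end_dfa"
  shows "end_sem (end_step q (a, n mod 2, x mod 2)) f (n div 2) (x div 2) \<longleftrightarrow>
    end_sem q (a # f) n x"
proof (cases "q = EInit")
  case True
  have "a \<noteq> 0" using assms by auto
  have "end_sem q (a # f) n x \<longleftrightarrow> n \<le> 2 ^ length f \<and> x = run_end (a # f) n"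
    by (simp add: True)
  then show ?thesis unfolding run_end_Cons_iff[OF assms(1)] unfolding True using \<open>a \<noteq> 0\<close>
    by (cases n rule: nat_bit_cases; cases x rule: nat_bit_cases; simp add: double_simps)
      (auto simp: double_simps)
next
  case False
  have "a = -1 \<or> a = 1" using assms(1) by simp
  then show ?thesis using assms(2) False
    by (cases q; cases n rule: nat_bit_cases; cases x rule: nat_bit_cases)
      (auto simp: end_dfa_def double_simps entry_Cons_simps)
qed

lemma synchronized_end: "synchronized_for end_dfa run_end"
proof -
  have "accepts end_dfa (parallel_input L f n x) \<longleftrightarrow> end_sem EInit f n x"
    if "set f \<subseteq> {-1, 1}" "length f \<le> L" "n < 2 ^ L" "x < 2 ^ L" for f n x L
  proof -
    have "q \<in> final end_dfa \<longleftrightarrow> end_sem q [] 0 0" if "q \<in> states end_dfa" for q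
      using that by (auto simp: end_dfa_def)
    moreover have "step end_dfa = end_step" "init end_dfa = EInit" by (simp_all add: end_dfa_def)
    ultimately show ?thesis
      using accepts_iff_sem[OF is_dfa_end, where sem = end_sem] end_sem_Nil end_sem_Cons that by simp
  qed
  then show ?thesis by (auto simp: synchronized_for_def)
qed

theorem theorem2:
  shows "(\<exists>M :: (nat, int \<times> nat \<times> nat) dfa.
            is_dfa input_alphabet M \<and> card (states M) = 17 \<and> synchronized_for M run_start) \<and>
         (\<exists>M :: (nat, int \<times> nat \<times> nat) dfa.
            is_dfa input_alphabet M \<and> card (states M) = 13 \<and> synchronized_for M run_end)"
  using ex_nat_dfa_synchronized[OF is_dfa_start _ synchronized_start]
    ex_nat_dfa_synchronized[OF is_dfa_end _ synchronized_end]
  by (simp add: card_start card_end)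

end
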